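(* Let $W\subseteq\mathbb{R}^n$ be a linear space such that the linear matroid $\mathcal M(W)$ is non-separable. Then (i) for any distinct $i,j,k\in[n]$, $\mathcal K_{ij}^W\subseteq \mathcal K_{ik}^W\cdot\mathcal K_{kj}^W$; and (ii) for any distinct $i,j,k\in[n]$, $\kappa^W_{ij}\le \kappa^W_{ik}\cdot\kappa^W_{kj}$.
   Context: An elementary vector of $W$ is a nonzero $g\in W$ whose support is inclusion-minimal among nonzero vectors of $W$; $\mathcal F(W)$ is their set, and the circuits of $W$ are their supports. $\mathcal M(W)$ is the matroid on $[n]$ whose circuits are the circuits of $W$; it is non-separable if $[n]$ cannot be partitioned into nonempty $S,T$ with every independent set $I$ satisfying $I$ independent iff $I\cap S$ and $I\cap T$ are (equivalently, every pair $i,j$ lies in a common circuit). For $i,j\in[n]$: $\mathcal K_{ij}^W=\{|g_j/g_i|:\ g\in\mathcal F(W),\ \{i,j\}\subseteq\mathrm{supp}(g)\}$ and $\kappa^W_{ij}=\max\mathcal K^W_{ij}$. For sets $S,T\subseteq\mathbb{R}$, $S\cdot T=\{st: s\in S,t\in T\}$. *)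

theory Defs
  imports "HOL-Analysis.Analysis" "HOL-Library.Set_Algebras"
begin

text \<open>The ground set \<open>[n]\<close> is the finite index type \<open>'n\<close>, with \<open>n = CARD('n)\<close>.\<close>

definition supp :: "real ^ 'n \<Rightarrow> 'n set" where
  "supp g = {i. g $ i \<noteq> 0}"

definition elementary_vectors :: "(real ^ 'n) set \<Rightarrow> (real ^ 'n) set" where
  "elementary_vectors W =
    {g \<in> W. g \<noteq> 0 \<and> (\<forall>h \<in> W. h \<noteq> 0 \<longrightarrow> \<not> supp h \<subset> supp g)}"

definition circuits :: "(real ^ 'n) set \<Rightarrow> 'n set set" where
  "circuits W = supp ` elementary_vectors W"

text \<open>The matroid \<open>\<M>(W)\<close> is represented by its independence predicate on subsets of \<open>[n]\<close>:
  the matroid with a given family of circuits has as its independent sets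
  exactly the sets that contain no circuit.\<close>

definition matroid_indep :: "(real ^ 'n) set \<Rightarrow> 'n set \<Rightarrow> bool" where
  "matroid_indep W I \<longleftrightarrow> \<not> (\<exists>C \<in> circuits W. C \<subseteq> I)"

definition non_separable :: "('n set \<Rightarrow> bool) \<Rightarrow> bool" where
  "non_separable indep \<longleftrightarrow>
    \<not> (\<exists>S T. S \<noteq> {} \<and> T \<noteq> {} \<and> S \<inter> T = {} \<and> S \<union> T = UNIV \<and>
          (\<forall>I. indep I \<longleftrightarrow> indep (I \<inter> S) \<and> indep (I \<inter> T)))"

definition circuit_ratios :: "(real ^ 'n) set \<Rightarrow> 'n \<Rightarrow> 'n \<Rightarrow> real set" where
  "circuit_ratios W i j =
    {\<bar>g $ j / g $ i\<bar> | g. g \<in> elementary_vectors W \<and> {i, j} \<subseteq> supp g}"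

text \<open>The set of ratios is finite for every linear space \<open>W\<close> (lemma \<open>finite_circuit_ratios\<close>),
  and it is nonempty for distinct indices when \<open>\<M>(W)\<close> is non-separable,
  so the maximum below is then attained.\<close>

definition kappa :: "(real ^ 'n) set \<Rightarrow> 'n \<Rightarrow> 'n \<Rightarrow> real" where
  "kappa W i j = Max (circuit_ratios W i j)"

lemma elementary_vectors_proportional:
  assumes W: "subspace W" and g: "g \<in> elementary_vectors W" and h: "h \<in> elementary_vectors W"
    and eq: "supp g = supp h" and i: "i \<in> supp g"
  shows "g = (g $ i / h $ i) *\<^sub>R h"
proof (rule ccontr)
  let ?d = "g - (g $ i / h $ i) *\<^sub>R h"
  have pt: "g $ k = 0 \<longleftrightarrow> h $ k = 0" for k
    using eq by (force simp: supp_def set_eq_iff)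
  assume "g \<noteq> (g $ i / h $ i) *\<^sub>R h"
  hence "?d \<noteq> 0" by simp
  moreover have "?d \<in> W"
    using W g h by (auto simp: elementary_vectors_def intro: subspace_diff subspace_scale)
  ultimately have "\<not> supp ?d \<subset> supp g"
    using g by (simp add: elementary_vectors_def)
  moreover have "supp ?d \<subseteq> supp g"
  proof
    fix k assume "k \<in> supp ?d"
    thus "k \<in> supp g"
      using pt[of k] by (cases "g $ k = 0") (simp_all add: supp_def)
  qed
  moreover have "i \<notin> supp ?d"
  proof -
    have "h $ i \<noteq> 0" using i pt[of i] by (simp add: supp_def)
    thus ?thesis by (simp add: supp_def)
  qed
  ultimately show False
    using i by (metis psubsetI)
qed

lemma finite_circuit_ratios:
  fixes W :: "(real ^ 'n) set"
  assumes W: "subspace W"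
  shows "finite (circuit_ratios W i j)"
proof -
  let ?G = "{g \<in> elementary_vectors W. {i, j} \<subseteq> supp g}"
  define rep where "rep C = (SOME h. h \<in> ?G \<and> supp h = C)" for C
  define r where "r C = \<bar>rep C $ j / rep C $ i\<bar>" for C
  have r: "\<bar>g $ j / g $ i\<bar> = r (supp g)" if g: "g \<in> ?G" for g
  proof -
    define h where "h = rep (supp g)"
    have hG: "h \<in> ?G \<and> supp h = supp g"
      unfolding h_def rep_def by (rule someI[of _ g]) (use g in simp)
    note h = conjunct1[OF hG] conjunct2[OF hG]
    have "g = (g $ i / h $ i) *\<^sub>R h"
      using g by (intro elementary_vectors_proportional[OF W _ _ h(2)[symmetric]])
        (use h(1) in simp_all)
    from arg_cong[OF this, of "\<lambda>x. x $ j"]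
    have "g $ j = (g $ i / h $ i) * h $ j" by (simp only: vector_scaleR_component real_scaleR_def)
    moreover have "g $ i \<noteq> 0" "h $ i \<noteq> 0" using g h(1) by (simp_all add: supp_def)
    ultimately have "g $ j / g $ i = h $ j / h $ i" by (simp add: field_simps)
    thus ?thesis by (simp add: r_def h_def)
  qed
  have "circuit_ratios W i j = (\<lambda>g. \<bar>g $ j / g $ i\<bar>) ` ?G"
    by (simp only: circuit_ratios_def setcompr_eq_image)
  also have "\<dots> = (\<lambda>g. r (supp g)) ` ?G"
    by (rule image_cong[OF refl r])
  also have "\<dots> \<subseteq> range r"
    by (rule image_subsetI) (rule rangeI)
  finally show ?thesis
    by (rule finite_subset) (rule finite_imageI, rule finite)
qed

end

theory Submission
  imports Defs
begin

text \<open>Let \<open>g\<close> be an elementary vector with support \<open>C\<close> containing \<open>i, j\<close> but not \<open>k\<close>. By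
  non-separability some circuit contains \<open>k\<close> and meets \<open>C\<close>; choose an elementary vector \<open>h\<close> of
  this kind with as few coordinates outside \<open>C\<close> as possible. Minimality forces the vectors of \<open>W\<close>
  supported on \<open>C \<union> supp h\<close> to form the plane spanned by \<open>g\<close> and \<open>h\<close>. With \<open>r e = h\<^sub>e / g\<^sub>e\<close>, the
  vectors \<open>h - r e g\<close> for \<open>e \<in> C\<close> are therefore elementary, and they all have the same
  \<open>k\<close>-coordinate. Since the \<open>i\<close>-coordinate of \<open>h - s g\<close> is \<open>g\<^sub>i (r i - s)\<close>, the values
  \<open>s = r j\<close>, \<open>t = r i\<close> (or any common value \<open>s = t\<close> other than \<open>r i\<close>, if \<open>r i = r j\<close>) yield two
  circuits whose ratios multiply to \<open>|g\<^sub>j / g\<^sub>i|\<close>. The same construction shows that lying in a common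
  circuit is a transitive relation.\<close>

text \<open>Induction on the support size: if \<open>q\<close> is not elementary, a nonzero
  \<open>p\<close> in \<open>W\<close> has strictly smaller support. Either \<open>p\<close> itself
  is nonzero at \<open>k\<close>, or subtracting a multiple of \<open>p\<close> kills a coordinate
  of \<open>q\<close> without changing the one at \<open>k\<close>.\<close>

lemma elementary_vector_through:
  assumes W: "subspace W" and "q \<in> W" "q $ k \<noteq> 0"
  shows "\<exists>h \<in> elementary_vectors W. h $ k \<noteq> 0 \<and> supp h \<subseteq> supp q"
  using assms(2,3)
proof (induction "card (supp q)" arbitrary: q rule: less_induct)
  case less
  show ?case
  proof (cases "q \<in> elementary_vectors W")
    case True
    thus ?thesis using less.prems by blast
  next
    case False
    have "q \<noteq> 0" using less.prems by auto
    then obtain p where p: "p \<in> W" "p \<noteq> 0" "supp p \<subset> supp q"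
      using False less.prems by (auto simp: elementary_vectors_def)
    have "\<exists>q' \<in> W. q' $ k \<noteq> 0 \<and> supp q' \<subset> supp q"
    proof (cases "p $ k = 0")
      case True
      obtain u where u: "p $ u \<noteq> 0" using p(2) by (auto simp: vec_eq_iff)
      let ?q = "q - (q $ u / p $ u) *\<^sub>R p"
      have "?q \<in> W" using W less.prems p by (intro subspace_diff subspace_scale)
      moreover have "?q $ k \<noteq> 0" using True less.prems by simp
      moreover have "supp ?q \<subseteq> supp q"
        using p(3) by (auto simp: supp_def)
      moreover have "u \<in> supp q" "u \<notin> supp ?q"
        using p(3) u by (auto simp: supp_def)
      ultimately show ?thesis by blast
    qed (use p in blast)
    then obtain q' where q': "q' \<in> W" "q' $ k \<noteq> 0" "supp q' \<subset> supp q" by blast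
    have "card (supp q') < card (supp q)"
      by (intro psubset_card_mono q') simp
    from less.hyps[OF this q'(1,2)] q'(3) show ?thesis by blast
  qed
qed

lemma supported_in_circuit_multiple:
  assumes W: "subspace W" and g: "g \<in> elementary_vectors W"
    and "p \<in> W" "supp p \<subseteq> supp g"
  shows "\<exists>a. p = a *\<^sub>R g"
proof -
  have "g \<noteq> 0" and gW: "g \<in> W" using g by (auto simp: elementary_vectors_def)
  then obtain x where x: "g $ x \<noteq> 0" by (auto simp: vec_eq_iff)
  let ?d = "p - (p $ x / g $ x) *\<^sub>R g"
  have "?d \<in> W" using W assms(3) gW by (intro subspace_diff subspace_scale)
  moreover have "supp ?d \<subseteq> supp g" using assms(4) by (auto simp: supp_def)
  moreover have "x \<in> supp g" "x \<notin> supp ?d" using x by (auto simp: supp_def)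
  ultimately have "?d = 0" using g unfolding elementary_vectors_def by blast
  thus ?thesis by (intro exI[of _ "p $ x / g $ x"]) simp
qed

text \<open>The last conclusion says that the ratios are not constant on the circuit of
  \<open>g\<close>. Hence for each \<open>x\<close> there, some elementary member of the pencil is
  nonzero at \<open>x\<close>.\<close>

lemma elementary_pencil:
  fixes W :: "(real ^ 'n) set"
  assumes W: "subspace W" and g: "g \<in> elementary_vectors W" and k: "g $ k = 0"
    and ex: "\<exists>h \<in> elementary_vectors W. h $ k \<noteq> 0 \<and> supp h \<inter> supp g \<noteq> {}"
  obtains h where "h $ k \<noteq> 0"
    and "\<And>e. g $ e \<noteq> 0 \<Longrightarrow> h - (h $ e / g $ e) *\<^sub>R g \<in> elementary_vectors W"
    and "\<And>x. g $ x \<noteq> 0 \<Longrightarrow> \<exists>e. g $ e \<noteq> 0 \<and> h $ e / g $ e \<noteq> h $ x / g $ x"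
proof -
  let ?P = "\<lambda>h. h \<in> elementary_vectors W \<and> h $ k \<noteq> 0 \<and> supp h \<inter> supp g \<noteq> {}"
  from ex obtain h0 where "?P h0" by blast
  from ex_has_least_nat[of ?P, OF this, of "\<lambda>h. card (supp h - supp g)"]
  obtain h where h: "?P h"
    and h_min: "\<And>h'. ?P h' \<Longrightarrow> card (supp h - supp g) \<le> card (supp h' - supp g)" by blast
  have gW: "g \<in> W" "g \<noteq> 0" and hW: "h \<in> W" using g h by (auto simp: elementary_vectors_def)
  have h_el: "\<not> supp p \<subset> supp h" if "p \<in> W" "p \<noteq> 0" for p
    using h that by (auto simp: elementary_vectors_def)
  \<comment> \<open>This is where the minimal choice of \<open>h\<close> enters. If \<open>p\<close>
    had a coordinate \<open>u\<close> outside the circuit of \<open>g\<close>, eliminating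
    \<open>u\<close> from \<open>h\<close> by means of \<open>p\<close> would keep the
    \<open>k\<close>-coordinate. An elementary \<open>h'\<close> through \<open>k\<close> inside the
    result either misses \<open>supp g\<close>, so lies properly inside \<open>supp h\<close>, or
    beats \<open>h\<close> in \<open>h_min\<close>.\<close>
  have in_C: "supp p \<subseteq> supp g" if p: "p \<in> W" "supp p \<subseteq> supp g \<union> supp h" "p $ k = 0" for p
  proof (rule ccontr)
    assume "\<not> supp p \<subseteq> supp g"
    then obtain u where u: "u \<in> supp p" "u \<notin> supp g" by blast
    let ?q = "h - (h $ u / p $ u) *\<^sub>R p"
    have "?q \<in> W" using W hW p by (intro subspace_diff subspace_scale)
    moreover have "?q $ k \<noteq> 0" using h p by simp
    ultimately obtain h' where h': "h' \<in> elementary_vectors W" "h' $ k \<noteq> 0" "supp h' \<subseteq> supp ?q"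
      using elementary_vector_through[OF W] by blast
    have "supp ?q \<subseteq> supp g \<union> supp h"
      using p(2) by (auto simp: supp_def)
    moreover have "u \<notin> supp ?q" using u by (auto simp: supp_def)
    ultimately have sub: "supp h' \<subseteq> supp g \<union> supp h - {u}" using h' by blast
    show False
    proof (cases "supp h' \<inter> supp g = {}")
      case True
      hence "supp h' \<subset> supp h" using sub h by blast
      moreover have "h' \<in> W" "h' \<noteq> 0" using h' by (auto simp: elementary_vectors_def)
      ultimately show False using h_el by blast
    next
      case False
      have "supp h' - supp g \<subset> supp h - supp g" using sub u p(2) by blast
      hence "card (supp h' - supp g) < card (supp h - supp g)"
        by (intro psubset_card_mono) simp_all
      thus False using h_min[of h'] h' False by simp
    qed
  qed
  show thesis
  proof (rule that[of h])
    show "h $ k \<noteq> 0" using h by blast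
  next
    fix e assume e: "g $ e \<noteq> 0"
    define f where "f = h - (h $ e / g $ e) *\<^sub>R g"
    have fW: "f \<in> W" unfolding f_def using W hW gW by (intro subspace_diff subspace_scale)
    have fk: "f $ k \<noteq> 0" and fe: "f $ e = 0" using h k e by (auto simp: f_def)
    have fs: "supp f \<subseteq> supp g \<union> supp h" by (auto simp: f_def supp_def)
    have "\<not> supp p \<subset> supp f" if p: "p \<in> W" "p \<noteq> 0" for p
    proof
      assume sub: "supp p \<subset> supp f"
      hence pe: "p $ e = 0" using fe by (auto simp: supp_def)
      \<comment> \<open>Vectors of \<open>W\<close> on \<open>supp g \<union> supp h\<close> are
        thus determined by their coordinates at \<open>k\<close> and \<open>e\<close>. As
        \<open>p\<close> and \<open>f\<close> both vanish at \<open>e\<close>, they are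
        proportional, so \<open>p\<close> cannot have smaller support.\<close>
      have mult_g: "v = 0" if v: "v \<in> W" "supp v \<subseteq> supp g \<union> supp h" "v $ k = 0" "v $ e = 0" for v
      proof -
        obtain a where a: "v = a *\<^sub>R g"
          using supported_in_circuit_multiple[OF W g v(1) in_C[OF v(1-3)]] by blast
        thus "v = 0" using v(4) e by simp
      qed
      have pk: "p $ k \<noteq> 0" using mult_g[of p] p pe sub fs by blast
      let ?v = "f - (f $ k / p $ k) *\<^sub>R p"
      have "?v = 0"
      proof (rule mult_g)
        show "?v \<in> W" using W fW p by (intro subspace_diff subspace_scale)
        have "supp ?v \<subseteq> supp f \<union> supp p" by (auto simp: supp_def)
        thus "supp ?v \<subseteq> supp g \<union> supp h" using sub fs by blast
        show "?v $ k = 0" "?v $ e = 0" using pk pe fe by simp_all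
      qed
      hence "f = (f $ k / p $ k) *\<^sub>R p" by simp
      hence "supp f = supp ((f $ k / p $ k) *\<^sub>R p)" by (rule arg_cong)
      hence "supp f \<subseteq> supp p" by (auto simp: supp_def)
      thus False using sub by blast
    qed
    thus "h - (h $ e / g $ e) *\<^sub>R g \<in> elementary_vectors W"
      using fW fk by (auto simp: elementary_vectors_def f_def[symmetric])
  next
    fix x assume x: "g $ x \<noteq> 0"
    show "\<exists>e. g $ e \<noteq> 0 \<and> h $ e / g $ e \<noteq> h $ x / g $ x"
    proof (rule ccontr)
      assume "\<not> ?thesis"
      hence eq: "h $ e = (h $ x / g $ x) * g $ e" if "g $ e \<noteq> 0" for e
        using that by (metis nonzero_divide_eq_eq)
      \<comment> \<open>With a constant ratio, this vector vanishes on all of \<open>supp g\<close>,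
        which \<open>h\<close> meets. Its support is then properly inside that of
        \<open>h\<close>.\<close>
      let ?v = "h - (h $ x / g $ x) *\<^sub>R g"
      have "?v \<in> W" using W hW gW by (intro subspace_diff subspace_scale)
      moreover have "?v $ k \<noteq> 0" using h k by simp
      hence "?v \<noteq> 0" by (metis zero_index)
      moreover have "supp ?v \<subseteq> supp h - supp g"
      proof
        fix e assume "e \<in> supp ?v"
        thus "e \<in> supp h - supp g" using eq[of e] by (cases "g $ e = 0") (simp_all add: supp_def)
      qed
      hence "supp ?v \<subset> supp h" using h by blast
      ultimately show False using h_el by blast
    qed
  qed
qed

lemma common_circuit_trans:
  fixes W :: "(real ^ 'n) set"
  assumes W: "subspace W"
    and h: "h \<in> elementary_vectors W" "h $ k \<noteq> 0" "h $ y \<noteq> 0"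
    and g: "g \<in> elementary_vectors W" "g $ y \<noteq> 0" "g $ z \<noteq> 0"
  shows "\<exists>f \<in> elementary_vectors W. f $ k \<noteq> 0 \<and> f $ z \<noteq> 0"
proof (cases "g $ k = 0")
  case True
  have "\<exists>h \<in> elementary_vectors W. h $ k \<noteq> 0 \<and> supp h \<inter> supp g \<noteq> {}"
    using h g by (intro bexI[of _ h]) (auto simp: supp_def)
  from elementary_pencil[OF W g(1) True this] obtain h' where h': "h' $ k \<noteq> 0"
    "\<And>e. g $ e \<noteq> 0 \<Longrightarrow> h' - (h' $ e / g $ e) *\<^sub>R g \<in> elementary_vectors W"
    "\<And>x. g $ x \<noteq> 0 \<Longrightarrow> \<exists>e. g $ e \<noteq> 0 \<and> h' $ e / g $ e \<noteq> h' $ x / g $ x" by metis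
  \<comment> \<open>The pencil member vanishing at \<open>e\<close> is nonzero at \<open>z\<close>
    exactly because the two ratios differ.\<close>
  obtain e where e: "g $ e \<noteq> 0" "h' $ e / g $ e \<noteq> h' $ z / g $ z" using h'(3) g(3) by blast
  have "(h' - (h' $ e / g $ e) *\<^sub>R g) $ z \<noteq> 0"
    using e g(3) by (auto simp: field_simps)
  moreover have "(h' - (h' $ e / g $ e) *\<^sub>R g) $ k \<noteq> 0" using h'(1) True by simp
  ultimately show ?thesis using h'(2)[OF e(1)] by blast
qed (use g in blast)

lemma non_separable_common_circuit:
  fixes W :: "(real ^ 'n) set"
  assumes W: "subspace W" and ns: "non_separable (matroid_indep W)" and "i \<noteq> j"
  shows "\<exists>g \<in> elementary_vectors W. g $ i \<noteq> 0 \<and> g $ j \<noteq> 0"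
proof (rule ccontr)
  assume no: "\<not> ?thesis"
  \<comment> \<open>The connected component of \<open>i\<close>. The disjunct \<open>x = i\<close>
    keeps it nonempty even if no circuit contains \<open>i\<close>. By transitivity no circuit
    crosses its boundary, so \<open>S\<close> and its complement would separate the matroid.\<close>
  define S where "S = {x. x = i \<or> (\<exists>g \<in> elementary_vectors W. g $ i \<noteq> 0 \<and> g $ x \<noteq> 0)}"
  have cross: "C \<subseteq> S \<or> C \<subseteq> - S" if "C \<in> circuits W" for C
  proof (rule ccontr)
    assume "\<not> ?thesis"
    then obtain y z where yz: "y \<in> C" "y \<in> S" "z \<in> C" "z \<notin> S" by blast
    from that obtain g where g: "g \<in> elementary_vectors W" "C = supp g"
      by (auto simp: circuits_def)
    hence gyz: "g $ y \<noteq> 0" "g $ z \<noteq> 0" using yz by (auto simp: supp_def)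
    have "\<exists>f \<in> elementary_vectors W. f $ i \<noteq> 0 \<and> f $ z \<noteq> 0"
    proof (cases "y = i")
      case True
      thus ?thesis using g gyz by blast
    next
      case False
      then obtain h where "h \<in> elementary_vectors W" "h $ i \<noteq> 0" "h $ y \<noteq> 0"
        using yz(2) by (auto simp: S_def)
      from common_circuit_trans[OF W this g(1) gyz] show ?thesis .
    qed
    thus False using yz(4) by (auto simp: S_def)
  qed
  have "\<forall>I. matroid_indep W I \<longleftrightarrow> matroid_indep W (I \<inter> S) \<and> matroid_indep W (I \<inter> - S)"
    using cross unfolding matroid_indep_def le_inf_iff by metis
  moreover have "S \<noteq> {}" "- S \<noteq> {}" using no \<open>i \<noteq> j\<close> by (auto simp: S_def)
  ultimately show False using ns Compl_disjoint[of S] Compl_partition[of S]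
    unfolding non_separable_def by metis
qed

lemma circuit_ratiosI:
  assumes "g \<in> elementary_vectors W" "g $ i \<noteq> 0" "g $ j \<noteq> 0"
  shows "\<bar>g $ j / g $ i\<bar> \<in> circuit_ratios W i j"
  using assms by (auto simp: circuit_ratios_def supp_def)

lemma circuit_ratios_subset_times:
  fixes W :: "(real ^ 'n) set"
  assumes W: "subspace W" and ns: "non_separable (matroid_indep W)" and "i \<noteq> k"
  shows "circuit_ratios W i j \<subseteq> circuit_ratios W i k * circuit_ratios W k j"
proof
  fix c assume "c \<in> circuit_ratios W i j"
  then obtain g where g: "g \<in> elementary_vectors W" "g $ i \<noteq> 0" "g $ j \<noteq> 0"
    and c: "c = \<bar>g $ j / g $ i\<bar>"
    by (auto simp: circuit_ratios_def supp_def)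
  show "c \<in> circuit_ratios W i k * circuit_ratios W k j"
  proof (cases "g $ k = 0")
    case False
    have "c = \<bar>g $ k / g $ i\<bar> * \<bar>g $ j / g $ k\<bar>" using c False by simp
    thus ?thesis using circuit_ratiosI[of g W] g False by (metis set_times_intro)
  next
    case True
    from non_separable_common_circuit[OF W ns \<open>i \<noteq> k\<close>]
    obtain h0 where h0: "h0 \<in> elementary_vectors W" "h0 $ i \<noteq> 0" "h0 $ k \<noteq> 0" by blast
    have "\<exists>h \<in> elementary_vectors W. h $ k \<noteq> 0 \<and> supp h \<inter> supp g \<noteq> {}"
      using h0 g by (intro bexI[of _ h0]) (auto simp: supp_def)
    from elementary_pencil[OF W g(1) True this] obtain h where h: "h $ k \<noteq> 0"
      "\<And>e. g $ e \<noteq> 0 \<Longrightarrow> h - (h $ e / g $ e) *\<^sub>R g \<in> elementary_vectors W"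
      "\<And>x. g $ x \<noteq> 0 \<Longrightarrow> \<exists>e. g $ e \<noteq> 0 \<and> h $ e / g $ e \<noteq> h $ x / g $ x" by metis
    define r where "r e = h $ e / g $ e" for e
    have coord: "(h - s *\<^sub>R g) $ x = g $ x * (r x - s)" if "g $ x \<noteq> 0" for s x
      using that by (simp add: r_def field_simps)
    \<comment> \<open>The vectors \<open>p\<close> and \<open>q\<close> below vanish at
      \<open>a\<close> and \<open>b\<close>. The inequalities keep \<open>p $ i\<close> and
      \<open>q $ j\<close> nonzero, and the equality of distances makes the extra factors cancel in
      the product of the ratios.\<close>
    have "\<exists>a b. g $ a \<noteq> 0 \<and> g $ b \<noteq> 0 \<and> r a \<noteq> r i \<and> r b \<noteq> r j \<and> \<bar>r j - r b\<bar> = \<bar>r i - r a\<bar>"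
    proof (cases "r i = r j")
      case True
      obtain a where "g $ a \<noteq> 0" "r a \<noteq> r i" using h(3)[OF g(2)] by (auto simp: r_def)
      thus ?thesis using True by metis
    next
      case False
      thus ?thesis using g by (intro exI[of _ j] exI[of _ i]) auto
    qed
    then obtain a b where ab: "g $ a \<noteq> 0" "g $ b \<noteq> 0" "r a \<noteq> r i" "r b \<noteq> r j"
      "\<bar>r j - r b\<bar> = \<bar>r i - r a\<bar>" by blast
    define p q where "p = h - r a *\<^sub>R g" and "q = h - r b *\<^sub>R g"
    have pq: "p \<in> elementary_vectors W" "q \<in> elementary_vectors W"
      using h(2) ab by (auto simp: p_def q_def r_def)
    have k_coord: "p $ k = h $ k" "q $ k = h $ k" using True by (auto simp: p_def q_def)
    have pi: "p $ i = g $ i * (r i - r a)" and qj: "q $ j = g $ j * (r j - r b)"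
      using coord g by (auto simp: p_def q_def)
    have "\<bar>p $ k / p $ i\<bar> * \<bar>q $ j / q $ k\<bar> = \<bar>g $ j / g $ i\<bar> * (\<bar>r j - r b\<bar> / \<bar>r i - r a\<bar>)"
      using h(1) unfolding k_coord pi qj by (simp add: abs_mult)
    hence "c = \<bar>p $ k / p $ i\<bar> * \<bar>q $ j / q $ k\<bar>" using ab c by simp
    moreover have "\<bar>p $ k / p $ i\<bar> \<in> circuit_ratios W i k"
      using pq h(1) g ab by (intro circuit_ratiosI) (auto simp: k_coord pi)
    moreover have "\<bar>q $ j / q $ k\<bar> \<in> circuit_ratios W k j"
      using pq h(1) g ab by (intro circuit_ratiosI) (auto simp: k_coord qj)
    ultimately show ?thesis by (metis set_times_intro)
  qed
qed

text \<open>A common circuit of \<open>i\<close> and \<open>j\<close> makes the ratio set nonempty,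
  so the maximum is attained. The attained ratio factors, and each factor is nonnegative and bounded
  by its own maximum.\<close>

lemma kappa_le_times:
  fixes W :: "(real ^ 'n) set"
  assumes W: "subspace W" and ns: "non_separable (matroid_indep W)" and "i \<noteq> j" "i \<noteq> k"
  shows "kappa W i j \<le> kappa W i k * kappa W k j"
proof -
  have "circuit_ratios W i j \<noteq> {}"
    using non_separable_common_circuit[OF W ns \<open>i \<noteq> j\<close>] circuit_ratiosI[of _ W i j] by blast
  hence "kappa W i j \<in> circuit_ratios W i j"
    unfolding kappa_def by (intro Max_in finite_circuit_ratios W)
  then obtain a b where ab: "a \<in> circuit_ratios W i k" "b \<in> circuit_ratios W k j"
    "kappa W i j = a * b"
    using circuit_ratios_subset_times[OF W ns \<open>i \<noteq> k\<close>] by (blast elim: set_times_elim)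
  have "a \<le> kappa W i k" "b \<le> kappa W k j"
    unfolding kappa_def using ab by (auto intro: Max_ge finite_circuit_ratios W)
  moreover have "0 \<le> a" "0 \<le> b" using ab by (auto simp: circuit_ratios_def)
  ultimately show ?thesis unfolding ab(3) by (intro mult_mono) auto
qed

theorem theorem3p21:
  fixes W :: "(real ^ 'n) set"
  assumes "subspace W"
    and "non_separable (matroid_indep W)"
  shows "(\<forall>i j k. i \<noteq> j \<and> i \<noteq> k \<and> j \<noteq> k \<longrightarrow>
            circuit_ratios W i j \<subseteq> circuit_ratios W i k * circuit_ratios W k j) \<and>
         (\<forall>i j k. i \<noteq> j \<and> i \<noteq> k \<and> j \<noteq> k \<longrightarrow>
            kappa W i j \<le> kappa W i k * kappa W k j)"
  using circuit_ratios_subset_times[OF assms] kappa_le_times[OF assms] by blast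

end
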